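(* Let $a,m\ge 2$ and $\tau=12\cdots(m-1)m^a$. If $n\ge a+m-1$, then the total number of occurrences of the subword $\tau$ within all the members of $NC_n$, i.e. $\sum_{\pi\in NC_n}\mu_\tau(\pi)$, is $\frac{r}{2r+m}\binom{2r+m}{r}$, where $r=n-a-m+2$.
   Context: A set partition of $[n]=\{1,\dots,n\}$ with blocks $B_1,\dots,B_k$ ordered so that $\min B_1<\cdots<\min B_k$ is represented by its canonical sequential form $\pi=\pi_1\cdots\pi_n$, where $i\in B_{\pi_i}$ for each $i$. It is non-crossing if $\pi$ contains no (not necessarily consecutive) subsequence of the form $a\,b\,a\,b$ with $a<b$. $NC_n$ denotes the set of non-crossing partitions of $[n]$, identified with their canonical sequential forms. An occurrence of a word $\tau=\tau_1\cdots\tau_k$ as a subword in a sequence $\sigma_1\cdots\sigma_n$ is an index $i\in[n-k+1]$ such that the string of consecutive letters $\sigma_i\cdots\sigma_{i+k-1}$ is order-isomorphic to $\tau$ (same relative order, including equalities). $\mu_\tau(\pi)$ denotes the number of occurrences of $\tau$ in $\pi$. Here $12\cdots(m-1)m^a$ denotes $1,2,\dots,m-1$ followed by $a$ copies of $m$. *)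

theory Defs
  imports Complex_Main "HOL-Library.Disjoint_Sets" "HOL-Library.Sublist"
begin

(* If the blocks of P are B_1, ..., B_k with increasing minima, then B_j is exactly the block for
   which j blocks have minimum at most Min B_j. *)
definition block_index :: "nat set set \<Rightarrow> nat set \<Rightarrow> nat" where
  "block_index P B = card {C \<in> P. Min C \<le> Min B}"

definition canonical_form :: "nat \<Rightarrow> nat set set \<Rightarrow> nat list" where
  "canonical_form n P = map (\<lambda>i. block_index P (THE B. B \<in> P \<and> i \<in> B)) [1..<Suc n]"

definition noncrossing :: "nat list \<Rightarrow> bool" where
  "noncrossing w \<longleftrightarrow> \<not> (\<exists>a b. a < b \<and> subseq [a, b, a, b] w)"

definition NC :: "nat \<Rightarrow> nat set set set" where
  "NC n = {P. partition_on {1..n} P \<and> noncrossing (canonical_form n P)}"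

definition order_isomorphic :: "nat list \<Rightarrow> nat list \<Rightarrow> bool" where
  "order_isomorphic u v \<longleftrightarrow> length u = length v \<and>
     (\<forall>i<length u. \<forall>j<length u. (u ! i < u ! j \<longleftrightarrow> v ! i < v ! j) \<and> (u ! i = u ! j \<longleftrightarrow> v ! i = v ! j))"

(* List positions are 0-based, so the index i here is one less than in the usual convention. *)
definition occurrences :: "nat list \<Rightarrow> nat list \<Rightarrow> nat" where
  "occurrences \<tau> w =
     card {i. i + length \<tau> \<le> length w \<and> order_isomorphic (take (length \<tau>) (drop i w)) \<tau>}"

end

theory Submission
  imports Defs
begin

text \<open>
  Canonical sequential forms of non-crossing partitions are built letter by letter. A prefix \<open>p\<close> can be
  extended by a new maximal letter or by a letter \<open>d\<close> of \<open>p\<close> that is not enclosed by a smaller one, that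
  is, with no \<open>a d a\<close>, \<open>a < d\<close>, inside \<open>p\<close>. If there are \<open>h\<close> such old letters, a new letter makes it
  \<open>h + 1\<close>, while repeating the \<open>j\<close>-th smallest leaves exactly the \<open>j\<close> smallest ones. Hence the number of
  extensions of length \<open>l\<close> depends on \<open>p\<close> only through \<open>h\<close> and satisfies a ballot recurrence. Since
  the last letter is always the largest available one, each ascent of an occurrence of
  \<open>1 2 \<dots> (m-1) m\<^sup>a\<close> must introduce a new letter, so an occurrence is forced once its first letter is
  placed. It raises \<open>h\<close> by \<open>u = m - 1\<close>, and the total number of occurrences satisfies the ballot
  recurrence with an additional ballot number as source term. Both recurrences have binomial solutions.
\<close>

section \<open>Ballot recurrences\<close>

fun ballot :: "nat \<Rightarrow> nat \<Rightarrow> nat" where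
  "ballot 0 h = 1"
| "ballot (Suc l) h = ballot l (Suc h) + (\<Sum>j=1..h. ballot l j)"

text \<open>Here \<open>l\<close> is not the length of the extension but its excess over the letters
  that an occurrence consumes after its first one. The term \<open>ballot (Suc l) (h + u)\<close>
  counts occurrences starting at the current last letter; the base value 1 is
  \<open>ballot 0 (h + u)\<close>.\<close>

fun marked_ballot :: "nat \<Rightarrow> nat \<Rightarrow> nat \<Rightarrow> nat" where
  "marked_ballot u 0 h = 1"
| "marked_ballot u (Suc l) h = ballot (Suc l) (h + u) +
     (marked_ballot u l (Suc h) + (\<Sum>j=1..h. marked_ballot u l j))"

lemma ballot_Suc_Suc: "ballot (Suc l) (Suc h) = ballot (Suc l) h + ballot l (Suc (Suc h))"
  by simp

text \<open>Ballot numbers as a difference of two binomials, written additively to avoid truncated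
  subtraction. Differencing in \<open>h\<close> removes the sum from the recurrence, so a double
  induction with Pascal's rule suffices.\<close>

lemma ballot_add_binomial:
  "ballot l h + ((2 * l + h) choose (l + h + 1)) = (2 * l + h) choose l"
proof (induction l arbitrary: h)
  case 0
  show ?case by simp
next
  case (Suc l)
  show ?case
  proof (induction h)
    case 0
    have "(2 * l + 1) choose (l + 1) = (2 * l + 1) choose l"
      using binomial_symmetric[of l "2 * l + 1"] by simp
    then show ?case using Suc.IH[of 1] by simp
  next
    case (Suc h)
    \<comment> \<open>The quoted fact is the outer hypothesis on \<open>l\<close>;
      \<open>Suc.IH\<close> now names the inner one on \<open>h\<close>.\<close>
    show ?case using Suc.IH \<open>\<And>h. ballot l h + _ = _\<close>[of "Suc (Suc h)"]
      unfolding ballot_Suc_Suc by (simp del: ballot.simps)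
  qed
qed

lemma marked_ballot_Suc_Suc:
  "marked_ballot u (Suc l) (Suc h) =
     marked_ballot u (Suc l) h + ballot l (Suc (Suc (h + u))) + marked_ballot u l (Suc (Suc h))"
  using ballot_Suc_Suc[of l "h + u"] by (simp del: ballot.simps)

lemma marked_ballot_eq_binomial:
  "marked_ballot u l h =
     ((2 * l + u + h) choose l) + h * ((2 * l + u + h) choose (l + u + h + 1))"
proof (induction l arbitrary: h)
  case 0
  show ?case by simp
next
  case (Suc l)
  note IHl = Suc.IH
  show ?case
  proof (induction h)
    case 0
    have "(2 * l + u + 1) choose (l + u + 1) = (2 * l + u + 1) choose l"
      using binomial_symmetric[of l "2 * l + u + 1"] by simp
    then show ?case using IHl[of 1] ballot_add_binomial[of "Suc l" u]
      by (simp del: ballot.simps)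
  next
    case (Suc h)
    \<comment> \<open>The source ballot number lowers the coefficient of the upper binomial from
      \<open>h + 2\<close> to \<open>h + 1\<close> and doubles the lower one. Symmetry then matches
      the result with Pascal's rule for both terms of the goal.\<close>
    have "(2 * l + u + h + 2) choose (l + u + h + 2) = (2 * l + u + h + 2) choose l"
      using binomial_symmetric[of l "2 * l + u + h + 2"] by (simp add: add_ac)
    then show ?case
      using Suc.IH IHl[of "Suc (Suc h)"] ballot_add_binomial[of l "Suc (Suc (h + u))"]
      unfolding marked_ballot_Suc_Suc
      by (simp del: ballot.simps marked_ballot.simps add: algebra_simps)
  qed
qed

text \<open>For \<open>h = 1\<close>, symmetry makes the two binomials neighbours in one row, and
  Pascal's rule merges them.\<close>

lemma marked_ballot_one: "marked_ballot u l 1 = (2 * l + u + 2) choose l"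
proof -
  have "(2 * l + u + 1) choose (l + u + 1) = (2 * l + u + 1) choose l"
    using binomial_symmetric[of l "2 * l + u + 1"] by simp
  moreover have "(2 * l + u + 2) choose (l + u + 2) = (2 * l + u + 2) choose l"
    using binomial_symmetric[of l "2 * l + u + 2"] by simp
  ultimately show ?thesis by (simp add: marked_ballot_eq_binomial)
qed

section \<open>Ranks\<close>

text \<open>Ranks grow strictly with \<open>f\<close>, so they inject \<open>A\<close> into an
  interval of the same size. Applied below to blocks ordered by minimum and to available
  letters.\<close>

lemma bij_betw_rank:
  fixes f :: "'a \<Rightarrow> 'b::linorder"
  assumes "finite A" "inj_on f A"
  shows "bij_betw (\<lambda>x. card {y \<in> A. f y \<le> f x}) A {1..card A}"
proof -
  let ?g = "\<lambda>x. card {y \<in> A. f y \<le> f x}"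
  have less: "?g x < ?g y" if "x \<in> A" "y \<in> A" "f x < f y" for x y
  proof (rule psubset_card_mono)
    have "y \<in> {z \<in> A. f z \<le> f y}" "y \<notin> {z \<in> A. f z \<le> f x}" using that by auto
    then show "{z \<in> A. f z \<le> f x} \<subset> {z \<in> A. f z \<le> f y}" using that by auto
  qed (use assms(1) in simp)
  have inj: "inj_on ?g A"
  proof (rule inj_onI)
    fix x y assume xy: "x \<in> A" "y \<in> A" "?g x = ?g y"
    then have "f x = f y" using less[of x y] less[of y x] by (metis less_irrefl linorder_cases)
    then show "x = y" using assms(2) xy by (auto dest: inj_onD)
  qed
  have "?g ` A \<subseteq> {1..card A}"
  proof (rule image_subsetI)
    fix x assume "x \<in> A"
    then have "{y \<in> A. f y \<le> f x} \<noteq> {}" by auto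
    then have "?g x \<noteq> 0" using assms(1) by simp
    moreover have "?g x \<le> card A" using assms(1) by (intro card_mono) auto
    ultimately show "?g x \<in> {1..card A}" by simp
  qed
  moreover have "card (?g ` A) = card {1..card A}" using inj by (simp add: card_image)
  ultimately have "?g ` A = {1..card A}" by (intro card_subset_eq) auto
  with inj show ?thesis by (simp add: bij_betw_def)
qed

section \<open>Canonical sequential forms\<close>

text \<open>Restricted growth words. Asking for all smaller positive letters to occur earlier avoids
  the maximum of a possibly empty prefix.\<close>

definition rgf :: "nat list \<Rightarrow> bool" where
  "rgf w \<longleftrightarrow> (\<forall>i<length w. 1 \<le> w ! i \<and> {1..<w ! i} \<subseteq> set (take i w))"

lemma rgf_Nil [simp]: "rgf []"
  by (simp add: rgf_def)

lemma rgf_snoc: "rgf (p @ [c]) \<longleftrightarrow> rgf p \<and> 1 \<le> c \<and> {1..<c} \<subseteq> set p"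
  unfolding rgf_def by (auto simp: nth_append less_Suc_eq)

lemma set_take_iff: "v \<in> set (take i w) \<longleftrightarrow> (\<exists>j. j < i \<and> j < length w \<and> w ! j = v)"
  by (auto simp: in_set_conv_nth)

lemma block_ex1:
  assumes "partition_on A P" "i \<in> A"
  shows "\<exists>!B. B \<in> P \<and> i \<in> B"
  using assms unfolding partition_on_def disjoint_def by blast

lemma block_the:
  assumes "partition_on A P" "B \<in> P" "i \<in> B"
  shows "(THE B. B \<in> P \<and> i \<in> B) = B"
  using assms block_ex1[OF assms(1), of i] partition_onD1[OF assms(1)]
  by (intro the_equality) auto

lemma length_canonical_form [simp]: "length (canonical_form n P) = n"
  by (simp add: canonical_form_def)

lemma canonical_form_nth:
  assumes "partition_on {1..n} P" "B \<in> P" "i \<in> B"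
  shows "i \<in> {1..n}" "canonical_form n P ! (i - 1) = block_index P B"
proof -
  show i: "i \<in> {1..n}" using assms partition_onD1 by fastforce
  have "canonical_form n P ! (i - 1) = block_index P (THE B. B \<in> P \<and> i \<in> B)"
    using i by (auto simp: canonical_form_def nth_append simp del: upt_Suc)
  then show "canonical_form n P ! (i - 1) = block_index P B"
    using block_the[OF assms] by simp
qed

lemma block_Min_in:
  assumes "partition_on {1..n::nat} P" "B \<in> P"
  shows "finite B" "Min B \<in> B"
proof -
  show "finite B" using assms finite_subset[of B "{1..n}"] by (auto simp: partition_on_def)
  moreover have "B \<noteq> {}" using assms partition_onD3 by blast
  ultimately show "Min B \<in> B" by simp
qed

lemma bij_betw_block_index:
  assumes "partition_on {1..n} P"
  shows "bij_betw (block_index P) P {1..card P}"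
proof -
  have "finite P" using finite_elements[OF _ assms] by simp
  moreover have "inj_on Min P"
    using block_Min_in(2)[OF assms] block_ex1[OF assms] partition_onD1[OF assms]
    by (intro inj_onI) (metis UnionI)
  ultimately show ?thesis using bij_betw_rank[of P Min] by (simp add: block_index_def[abs_def])
qed

lemma block_index_le_imp_Min_le:
  assumes "partition_on {1..n} P" "B \<in> P" "C \<in> P" "block_index P C \<le> block_index P B"
  shows "Min C \<le> Min B"
proof (rule ccontr)
  assume *: "\<not> Min C \<le> Min B"
  have "finite P" using finite_elements[OF _ assms(1)] by simp
  then have "block_index P B < block_index P C"
    unfolding block_index_def
  proof (intro psubset_card_mono)
    have "C \<in> {D \<in> P. Min D \<le> Min C}" "C \<notin> {D \<in> P. Min D \<le> Min B}" using * assms(3) by auto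
    then show "{D \<in> P. Min D \<le> Min B} \<subset> {D \<in> P. Min D \<le> Min C}" using * by auto
  qed simp
  then show False using assms(4) by simp
qed

text \<open>A block of smaller index has a smaller minimum, and the position of that minimum is the
  required earlier occurrence.\<close>

lemma rgf_canonical_form:
  assumes P: "partition_on {1..n} P"
  shows "rgf (canonical_form n P)"
  unfolding rgf_def
proof (intro allI impI)
  fix i assume i: "i < length (canonical_form n P)"
  let ?w = "canonical_form n P"
  obtain B where B: "B \<in> P" "Suc i \<in> B" using i block_ex1[OF P, of "Suc i"] by auto
  have wi: "?w ! i = block_index P B" using canonical_form_nth(2)[OF P B] by simp
  have range: "block_index P B \<in> {1..card P}"
    using bij_betw_block_index[OF P] B by (auto simp: bij_betw_def)
  have "v \<in> set (take i ?w)" if v: "1 \<le> v" "v < block_index P B" for v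
  proof -
    have "v \<in> block_index P ` P"
      using bij_betw_block_index[OF P] v range by (auto simp: bij_betw_def)
    then obtain C where C: "C \<in> P" "block_index P C = v" by auto
    have MC: "Min C \<in> C" "Min B \<in> B" "finite B" using block_Min_in[OF P] B C by auto
    have "B \<noteq> C" using C v by auto
    then have "Min C \<noteq> Min B" using MC B C block_ex1[OF P, of "Min C"] canonical_form_nth(1)[OF P]
      by metis
    moreover have "Min C \<le> Min B" using block_index_le_imp_Min_le[OF P B(1) C(1)] C v by simp
    moreover have "Min B \<le> Suc i" using MC B by simp
    moreover have "1 \<le> Min C" using canonical_form_nth(1)[OF P C(1) MC(1)] by simp
    ultimately have "Min C - 1 < i" by simp
    moreover have "?w ! (Min C - 1) = v" using canonical_form_nth(2)[OF P C(1) MC(1)] C by simp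
    ultimately show ?thesis using i by (auto simp: set_take_iff)
  qed
  then show "1 \<le> ?w ! i \<and> {1..<?w ! i} \<subseteq> set (take i ?w)" using wi range by auto
qed

text \<open>The level sets of the word, which invert \<open>canonical_form\<close>;
  \<open>i - 1\<close> converts elements of \<open>{1..n}\<close> to list positions.\<close>

definition kernel_partition :: "nat list \<Rightarrow> nat set set" where
  "kernel_partition w = (\<lambda>v. {i \<in> {1..length w}. w ! (i - 1) = v}) ` set w"

lemma partition_on_kernel_partition: "partition_on {1..length w} (kernel_partition w)"
proof (rule partition_onI)
  show "\<Union> (kernel_partition w) = {1..length w}"
    by (force simp: kernel_partition_def)
  show "{} \<notin> kernel_partition w"
  proof
    assume "{} \<in> kernel_partition w"
    then obtain j where "j < length w" "{i \<in> {1..length w}. w ! (i - 1) = w ! j} = {}"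
      by (auto simp: kernel_partition_def in_set_conv_nth)
    moreover have "Suc j \<in> {i \<in> {1..length w}. w ! (i - 1) = w ! j}" using calculation(1) by simp
    ultimately show False by blast
  qed
qed (auto simp: kernel_partition_def disjnt_def)

lemma kernel_partition_canonical_form:
  assumes P: "partition_on {1..n} P"
  shows "kernel_partition (canonical_form n P) = P"
proof -
  let ?w = "canonical_form n P"
  have cls: "{i \<in> {1..n}. ?w ! (i - 1) = block_index P B} = B" if B: "B \<in> P" for B
  proof (intro equalityI subsetI)
    fix i assume "i \<in> {i \<in> {1..n}. ?w ! (i - 1) = block_index P B}"
    then have i: "i \<in> {1..n}" "?w ! (i - 1) = block_index P B" by auto
    then obtain C where C: "C \<in> P" "i \<in> C" using block_ex1[OF P] by blast
    then have "block_index P C = block_index P B" using canonical_form_nth(2)[OF P C] i by simp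
    then have "C = B" using bij_betw_block_index[OF P] B C by (auto simp: bij_betw_def dest: inj_onD)
    then show "i \<in> B" using C by simp
  next
    fix i assume "i \<in> B"
    then show "i \<in> {i \<in> {1..n}. ?w ! (i - 1) = block_index P B}"
      using canonical_form_nth[OF P B] by auto
  qed
  have "set ?w = block_index P ` P"
  proof (intro equalityI subsetI)
    fix v assume "v \<in> set ?w"
    then obtain i where i: "i < n" "?w ! i = v" by (auto simp: in_set_conv_nth)
    then obtain B where "B \<in> P" "Suc i \<in> B" using block_ex1[OF P, of "Suc i"] by auto
    then show "v \<in> block_index P ` P" using canonical_form_nth(2)[OF P, of B "Suc i"] i by auto
  next
    fix v assume "v \<in> block_index P ` P"
    then obtain B where B: "B \<in> P" "v = block_index P B" by auto
    have *: "Min B \<in> B" using block_Min_in[OF P B(1)] by simp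
    have "Min B - 1 < n" using canonical_form_nth(1)[OF P B(1) *] by auto
    then show "v \<in> set ?w" using canonical_form_nth(2)[OF P B(1) *] B
      by (metis length_canonical_form nth_mem)
  qed
  then show ?thesis using cls by (simp add: kernel_partition_def image_image)
qed

text \<open>In a restricted growth word the letters make their first appearance in increasing order.
  Hence the level sets starting no later than that of \<open>v\<close> are those of
  \<open>1, ..., v\<close>, and the index of the level set of \<open>v\<close> is
  \<open>v\<close>.\<close>

lemma canonical_form_kernel_partition:
  assumes "rgf w"
  shows "canonical_form (length w) (kernel_partition w) = w"
proof (rule nth_equalityI)
  show "length (canonical_form (length w) (kernel_partition w)) = length w" by simp
next
  fix i assume "i < length (canonical_form (length w) (kernel_partition w))"
  then have i: "i < length w" by simp
  define cls where "cls v = {i \<in> {1..length w}. w ! (i - 1) = v}" for v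
  let ?P = "kernel_partition w" and ?v = "w ! i"
  note P = partition_on_kernel_partition[of w]
  have Pcls: "?P = cls ` set w" by (simp add: kernel_partition_def cls_def)
  have v: "?v \<in> set w" using i by simp
  have Min_cls: "Min (cls u) \<in> cls u" if "u \<in> set w" for u
    using block_Min_in[OF P] that Pcls by simp
  have earlier: "u \<in> set w \<and> Min (cls u) < Min (cls x)" if u: "1 \<le> u" "u < x" and x: "x \<in> set w" for u x
  proof -
    define j where "j = Min (cls x)"
    have j: "j \<in> {1..length w}" "w ! (j - 1) = x"
      using Min_cls[OF x] unfolding j_def by (auto simp: cls_def)
    then have "j - 1 < length w" by auto
    then have "u \<in> set (take (j - 1) w)" using assms u j unfolding rgf_def by fastforce
    then obtain k where k: "k < j - 1" "k < length w" "w ! k = u" by (auto simp: set_take_iff)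
    then have "Suc k \<in> cls u" by (simp add: cls_def)
    then have "Min (cls u) \<le> Suc k" by (simp add: cls_def)
    then show ?thesis using k j_def by auto
  qed
  have pos: "1 \<le> u" if "u \<in> set w" for u
    using that assms by (auto simp: rgf_def in_set_conv_nth)
  have "{C \<in> ?P. Min C \<le> Min (cls ?v)} = cls ` {1..?v}"
  proof (intro equalityI subsetI)
    fix C assume "C \<in> {C \<in> ?P. Min C \<le> Min (cls ?v)}"
    then obtain u where u: "u \<in> set w" "C = cls u" "Min (cls u) \<le> Min (cls ?v)"
      using Pcls by auto
    have "\<not> ?v < u" using earlier[OF pos[OF v] _ u(1)] u by auto
    then show "C \<in> cls ` {1..?v}" using u pos by auto
  next
    fix C assume "C \<in> cls ` {1..?v}"
    then obtain u where u: "1 \<le> u" "u \<le> ?v" "C = cls u" by auto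
    then have "u \<in> set w \<and> Min (cls u) \<le> Min (cls ?v)"
      using earlier[OF u(1) _ v] v by (cases "u = ?v") auto
    then show "C \<in> {C \<in> ?P. Min C \<le> Min (cls ?v)}" using u Pcls by auto
  qed
  moreover have "inj_on cls {1..?v}"
  proof (rule inj_onI)
    fix u x assume "u \<in> {1..?v}" "x \<in> {1..?v}" "cls u = cls x"
    moreover have "u \<in> set w" if "u \<in> {1..?v}" for u
      using earlier[of u ?v] v that by (cases "u = ?v") auto
    ultimately show "u = x" using Min_cls[of u] by (auto simp: cls_def)
  qed
  ultimately have "block_index ?P (cls ?v) = ?v" by (simp add: block_index_def card_image)
  moreover have "Suc i \<in> cls ?v" "cls ?v \<in> ?P" using i Pcls by (auto simp: cls_def)
  ultimately show "canonical_form (length w) ?P ! i = ?v"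
    using canonical_form_nth(2)[OF P, of "cls ?v" "Suc i"] by simp
qed

lemma bij_betw_canonical_form_NC:
  "bij_betw (canonical_form n) (NC n) {w. length w = n \<and> rgf w \<and> noncrossing w}"
proof (rule bij_betw_byWitness[where f' = kernel_partition])
  show "\<forall>P\<in>NC n. kernel_partition (canonical_form n P) = P"
    by (simp add: NC_def kernel_partition_canonical_form)
  show "\<forall>w\<in>{w. length w = n \<and> rgf w \<and> noncrossing w}. canonical_form n (kernel_partition w) = w"
    using canonical_form_kernel_partition by auto
  show "canonical_form n ` NC n \<subseteq> {w. length w = n \<and> rgf w \<and> noncrossing w}"
    by (auto simp: NC_def rgf_canonical_form)
  show "kernel_partition ` {w. length w = n \<and> rgf w \<and> noncrossing w} \<subseteq> NC n"
    using partition_on_kernel_partition canonical_form_kernel_partition by (auto simp: NC_def)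
qed

section \<open>Extensions of non-crossing words\<close>

abbreviation nc_word :: "nat list \<Rightarrow> bool" where
  "nc_word w \<equiv> rgf w \<and> noncrossing w"

text \<open>The old letters that may follow the non-crossing word \<open>p\<close>.\<close>

definition avail :: "nat list \<Rightarrow> nat set" where
  "avail p = {d \<in> set p. \<forall>a<d. \<not> subseq [a, d, a] p}"

text \<open>The letters of a restricted growth word form an initial interval, so their number
  determines the next letter, even for the empty word.\<close>

definition new_letter :: "nat list \<Rightarrow> nat" where
  "new_letter p = Suc (card (set p))"

definition extensions :: "nat list \<Rightarrow> nat \<Rightarrow> nat list set" where
  "extensions p l = {w. length w = l \<and> nc_word (p @ w)}"

lemma subseq_snoc_iff:
  "subseq (xs @ [x]) (ys @ [y]) \<longleftrightarrow> subseq (xs @ [x]) ys \<or> (x = y \<and> subseq xs ys)"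
proof
  assume "subseq (xs @ [x]) (ys @ [y])"
  then obtain us vs where uv: "xs @ [x] = us @ vs" "subseq us ys" "subseq vs [y]"
    by (auto simp: subseq_append_iff)
  show "subseq (xs @ [x]) ys \<or> (x = y \<and> subseq xs ys)"
  proof (cases vs rule: rev_cases)
    case Nil
    then show ?thesis using uv by simp
  next
    case (snoc ws z)
    then have "length ws = 0" using list_emb_length[OF uv(3)] by simp
    then show ?thesis using uv snoc by (auto split: if_splits)
  qed
next
  assume "subseq (xs @ [x]) ys \<or> (x = y \<and> subseq xs ys)"
  then show "subseq (xs @ [x]) (ys @ [y])"
    using subseq_rev_drop_many[of "xs @ [x]" ys "[y]"] by auto
qed

text \<open>A crossing created by appending \<open>c\<close> must use that \<open>c\<close> as its
  last letter.\<close>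

lemma noncrossing_snoc:
  "noncrossing (p @ [c]) \<longleftrightarrow> noncrossing p \<and> (\<forall>a<c. \<not> subseq [a, c, a] p)"
  using subseq_snoc_iff[of "[a, b, a]" b p c for a b] unfolding noncrossing_def by fastforce

lemma nc_word_appendD: "nc_word (p @ q) \<Longrightarrow> nc_word p"
proof (induction q rule: rev_induct)
  case (snoc c q)
  then show ?case using rgf_snoc[of "p @ q" c] noncrossing_snoc[of "p @ q" c] by simp
qed simp

lemma finite_avail [simp]: "finite (avail p)"
  by (simp add: avail_def)

lemma set_subseq: "subseq xs ys \<Longrightarrow> set xs \<subseteq> set ys"
  using list_emb_set[of "(=)" xs ys] by blast

lemma avail_subset: "avail p \<subseteq> set p"
  by (auto simp: avail_def)

lemma set_rgf: "rgf p \<Longrightarrow> set p = {1..<new_letter p}"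
proof (induction p rule: rev_induct)
  case (snoc c p)
  then have c: "1 \<le> c" "{1..<c} \<subseteq> set p" and "rgf p" by (auto simp: rgf_snoc)
  define k where "k = card (set p)"
  have p: "set p = {1..k}"
    using snoc.IH \<open>rgf p\<close> unfolding new_letter_def k_def
    by (metis atLeastLessThanSuc_atLeastAtMost)
  have "c \<le> Suc k"
  proof (rule ccontr)
    assume "\<not> c \<le> Suc k"
    then have "Suc k \<in> set p" using c by auto
    then show False using p by simp
  qed
  then have "set (p @ [c]) = {1..k} \<or> set (p @ [c]) = {1..Suc k}" using p c by auto
  then show ?case unfolding new_letter_def by (metis card_atLeastAtMost diff_Suc_1 atLeastLessThanSuc_atLeastAtMost)
qed (simp add: new_letter_def)

lemma new_letter_notin: "rgf p \<Longrightarrow> new_letter p \<notin> set p"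
  using set_rgf[of p] by auto

text \<open>By restricted growth, \<open>c\<close> has already occurred when \<open>d\<close>
  appears for the first time.\<close>

lemma subseq_pair_rgf:
  assumes "rgf p" "c \<in> set p" "d \<in> set p" "c < d"
  shows "subseq [c, d] p"
  using assms
proof (induction p rule: rev_induct)
  case (snoc x p)
  show ?case
  proof (cases "d \<in> set p")
    case True
    then have "c \<in> set p" using set_rgf[of p] set_rgf[of "p @ [x]"] snoc.prems by (auto simp: rgf_snoc)
    then show ?thesis using True snoc subseq_snoc_iff[of "[c]" d p x] by (auto simp: rgf_snoc)
  next
    case False
    then have x: "x = d" using snoc.prems by simp
    then have "c \<in> set p" using snoc.prems by auto
    then show ?thesis using x subseq_snoc_iff[of "[c]" d p x] by (simp add: subseq_singleton_left)
  qed
qed simp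

text \<open>Restricted growth allows the old letters and one new letter. Non-crossing cuts the old
  ones down to \<open>avail p\<close>, while the new letter, absent from \<open>p\<close>, completes
  no crossing.\<close>

lemma nc_word_snoc:
  assumes "nc_word p"
  shows "nc_word (p @ [c]) \<longleftrightarrow> c \<in> insert (new_letter p) (avail p)"
proof -
  have sp: "set p = {1..<new_letter p}" using assms set_rgf by simp
  have np: "1 \<le> new_letter p" by (simp add: new_letter_def)
  have "1 \<le> c \<and> {1..<c} \<subseteq> set p \<longleftrightarrow> c = new_letter p \<or> c \<in> set p"
  proof
    assume *: "1 \<le> c \<and> {1..<c} \<subseteq> set p"
    have "\<not> new_letter p < c"
    proof
      assume "new_letter p < c"
      then have "new_letter p \<in> {1..<c}" using np by simp
      then show False using * sp by auto
    qed
    then show "c = new_letter p \<or> c \<in> set p" using * sp by auto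
  qed (use sp np in auto)
  moreover have "\<not> subseq [a, new_letter p, a] p" for a
    using new_letter_notin[of p] assms set_subseq[of "[a, new_letter p, a]" p] by auto
  ultimately show ?thesis
    using assms unfolding rgf_snoc noncrossing_snoc by (auto simp: avail_def)
qed

section \<open>Effect of one more letter on the available letters\<close>

lemma avail_snoc_iff:
  "d \<in> avail (p @ [c]) \<longleftrightarrow> d \<in> insert c (set p) \<and> (\<forall>a<d. \<not> subseq [a, d, a] p) \<and>
     \<not> (c < d \<and> subseq [c, d] p)"
  using subseq_snoc_iff[of "[a, d]" a p c for a] unfolding avail_def by auto

text \<open>Every old \<open>d > c\<close> already occurs after some \<open>c\<close>, so the
  appended \<open>c\<close> completes \<open>c d c\<close> and encloses \<open>d\<close>.\<close>

lemma avail_snoc_old: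
  assumes "nc_word p" "c \<in> avail p"
  shows "avail (p @ [c]) = {d \<in> avail p. d \<le> c}"
proof -
  have "c \<in> set p" using assms avail_subset by auto
  then have "d \<in> avail (p @ [c]) \<longleftrightarrow> d \<in> avail p \<and> d \<le> c" for d
    using assms subseq_pair_rgf[of p c d] unfolding avail_snoc_iff
    by (cases "c < d") (auto simp: avail_def)
  then show ?thesis by auto
qed

lemma avail_snoc_new:
  assumes "nc_word p"
  shows "avail (p @ [new_letter p]) = insert (new_letter p) (avail p)"
proof -
  have "\<not> subseq [a, new_letter p, a] p" for a
    using new_letter_notin[of p] assms set_subseq[of "[a, new_letter p, a]" p] by auto
  then have "d \<in> avail (p @ [new_letter p]) \<longleftrightarrow> d = new_letter p \<or> d \<in> avail p" for d
    using assms set_rgf[of p] unfolding avail_snoc_iff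
    by (cases "d = new_letter p") (auto simp: avail_def)
  then show ?thesis by auto
qed

lemma less_new_letter: "nc_word p \<Longrightarrow> d \<in> avail p \<Longrightarrow> d < new_letter p"
  using avail_subset[of p] set_rgf[of p] by auto

lemma card_avail_snoc_new:
  "nc_word p \<Longrightarrow> card (avail (p @ [new_letter p])) = Suc (card (avail p))"
  using less_new_letter[of p] by (auto simp: avail_snoc_new card_insert_if)

text \<open>Both ways of appending \<open>c\<close> leave \<open>c\<close> as the largest available
  letter. Consequently an old letter can never produce an ascent.\<close>

lemma last_avail:
  assumes "nc_word p" "p \<noteq> []"
  shows "last p \<in> avail p" "\<And>d. d \<in> avail p \<Longrightarrow> d \<le> last p"
proof -
  obtain q c where p: "p = q @ [c]" using assms(2) by (metis append_butlast_last_id)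
  then have q: "nc_word q" using assms nc_word_appendD by blast
  then have "c = new_letter q \<or> c \<in> avail q" using nc_word_snoc[of q c] p assms by auto
  then show "last p \<in> avail p" "\<And>d. d \<in> avail p \<Longrightarrow> d \<le> last p"
    using p avail_snoc_old[OF q] avail_snoc_new[OF q] less_imp_le[OF less_new_letter[OF q]]
    by auto
qed

text \<open>Repeating the \<open>j\<close>-th smallest available letter leaves exactly
  \<open>j\<close> available, so the rank bijection reindexes the sum.\<close>

lemma sum_avail:
  assumes "nc_word p"
  shows "(\<Sum>c\<in>avail p. f (card (avail (p @ [c])))) = (\<Sum>j=1..card (avail p). f j)"
proof -
  have "(\<Sum>c\<in>avail p. f (card (avail (p @ [c])))) = (\<Sum>c\<in>avail p. f (card {d \<in> avail p. d \<le> c}))"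
    using assms avail_snoc_old by (intro sum.cong) auto
  also have "\<dots> = (\<Sum>j=1..card (avail p). f j)"
    using bij_betw_rank[of "avail p" "\<lambda>x. x"] by (intro sum.reindex_bij_betw) auto
  finally show ?thesis .
qed

section \<open>Enumerating extensions by their first letter\<close>

lemma extensions_0: "nc_word p \<Longrightarrow> extensions p 0 = {[]}"
  by (auto simp: extensions_def)

lemma extensions_Suc:
  assumes "nc_word p"
  shows "extensions p (Suc l) =
    (\<Union>c\<in>insert (new_letter p) (avail p). (#) c ` extensions (p @ [c]) l)"
proof (intro equalityI subsetI)
  fix w assume w: "w \<in> extensions p (Suc l)"
  then obtain c v where cv: "w = c # v" by (cases w) (auto simp: extensions_def)
  then have "v \<in> extensions (p @ [c]) l" using w by (simp add: extensions_def)
  moreover from this have "nc_word (p @ [c])"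
    using nc_word_appendD[of "p @ [c]" v] by (simp add: extensions_def)
  ultimately show "w \<in> (\<Union>c\<in>insert (new_letter p) (avail p). (#) c ` extensions (p @ [c]) l)"
    using nc_word_snoc[OF assms] cv by blast
qed (auto simp: extensions_def)

lemma finite_extensions: "nc_word p \<Longrightarrow> finite (extensions p l)"
proof (induction l arbitrary: p)
  case (Suc l)
  then show ?case using nc_word_snoc[of p] by (auto simp: extensions_Suc)
qed (simp add: extensions_0)

lemma sum_extensions_Suc:
  assumes "nc_word p"
  shows "(\<Sum>w\<in>extensions p (Suc l). f w) =
    (\<Sum>w\<in>extensions (p @ [new_letter p]) l. f (new_letter p # w)) +
    (\<Sum>c\<in>avail p. \<Sum>w\<in>extensions (p @ [c]) l. f (c # w))"
proof -
  let ?A = "insert (new_letter p) (avail p)"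
  have "(\<Sum>w\<in>extensions p (Suc l). f w) =
      (\<Sum>c\<in>?A. sum f ((#) c ` extensions (p @ [c]) l))"
    unfolding extensions_Suc[OF assms]
    by (intro sum.UNION_disjoint) (use assms nc_word_snoc finite_extensions in auto)
  also have "\<dots> = (\<Sum>c\<in>?A. \<Sum>w\<in>extensions (p @ [c]) l. f (c # w))"
    by (rule sum.cong[OF refl]) (simp add: sum.reindex)
  also have "\<dots> = (\<Sum>w\<in>extensions (p @ [new_letter p]) l. f (new_letter p # w)) +
      (\<Sum>c\<in>avail p. \<Sum>w\<in>extensions (p @ [c]) l. f (c # w))"
    using less_new_letter[OF assms] by (subst sum.insert) auto
  finally show ?thesis .
qed

lemma card_extensions: "nc_word p \<Longrightarrow> card (extensions p l) = ballot l (card (avail p))"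
proof (induction l arbitrary: p)
  case (Suc l)
  have "card (extensions p (Suc l)) = ballot l (card (avail (p @ [new_letter p]))) +
      (\<Sum>c\<in>avail p. ballot l (card (avail (p @ [c]))))"
    using Suc nc_word_snoc[of p] sum_extensions_Suc[of p "\<lambda>_. 1::nat" l] by simp
  then show ?case using Suc.prems card_avail_snoc_new sum_avail[of p "ballot l"] by simp
qed (simp add: extensions_0)

section \<open>Occurrences of the pattern\<close>

text \<open>
  \<open>climbs u f x w\<close>: after the letter \<open>x\<close>, the word \<open>w\<close> begins with \<open>u\<close> strict ascents followed by \<open>f\<close>
  repetitions. For \<open>u = m - 1\<close>, \<open>f = a - 1\<close> this is an occurrence of the pattern at the first position
  of \<open>x # w\<close>.
\<close>

fun climbs :: "nat \<Rightarrow> nat \<Rightarrow> nat \<Rightarrow> nat list \<Rightarrow> bool" where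
  "climbs (Suc u) f x (c # w) \<longleftrightarrow> x < c \<and> climbs u f c w"
| "climbs 0 (Suc f) x (c # w) \<longleftrightarrow> c = x \<and> climbs 0 f x w"
| "climbs 0 0 x w \<longleftrightarrow> True"
| "climbs _ _ x [] \<longleftrightarrow> False"

text \<open>The letter preceding \<open>w ! i\<close> is \<open>(x # w) ! i\<close>, which expresses
  all steps by position.\<close>

lemma climbs_iff_nth:
  "climbs u f x w \<longleftrightarrow> u + f \<le> length w \<and> (\<forall>i<u. (x # w) ! i < w ! i) \<and>
     (\<forall>i. u \<le> i \<and> i < u + f \<longrightarrow> w ! i = (x # w) ! i)"
proof (induction u f x w rule: climbs.induct)
  case (1 u f x c w)
  have "(\<forall>i<Suc u. (x # c # w) ! i < (c # w) ! i) \<longleftrightarrow> x < c \<and> (\<forall>i<u. (c # w) ! i < w ! i)"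
    by (auto simp: less_Suc_eq_0_disj)
  moreover have "(\<forall>i. Suc u \<le> i \<and> i < Suc u + f \<longrightarrow> (c # w) ! i = (x # c # w) ! i) \<longleftrightarrow>
      (\<forall>i. u \<le> i \<and> i < u + f \<longrightarrow> w ! i = (c # w) ! i)"
    (is "?L \<longleftrightarrow> ?R")
  proof
    show ?R if ?L
    proof (intro allI impI)
      fix i assume "u \<le> i \<and> i < u + f"
      then show "w ! i = (c # w) ! i" using that[rule_format, of "Suc i"] by simp
    qed
    show ?L if ?R
    proof (intro allI impI)
      fix i assume "Suc u \<le> i \<and> i < Suc u + f"
      then show "(c # w) ! i = (x # c # w) ! i" using that by (cases i) auto
    qed
  qed
  ultimately show ?case using 1 by auto
next
  case (2 f x c w)
  have "(\<forall>i<Suc f. (c # w) ! i = (x # c # w) ! i) \<longleftrightarrow> c = x \<and> (\<forall>i<f. w ! i = (x # w) ! i)"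
    unfolding All_less_Suc2 by auto
  then show ?case using 2 by auto
qed auto

lemma occurrences_Nil: "\<tau> \<noteq> [] \<Longrightarrow> occurrences \<tau> [] = 0"
  by (simp add: occurrences_def)

lemma occurrences_Cons:
  "occurrences \<tau> (x # w) =
     of_bool (length \<tau> \<le> length (x # w) \<and> order_isomorphic (take (length \<tau>) (x # w)) \<tau>) +
     occurrences \<tau> w"
proof -
  define Q where "Q v i \<longleftrightarrow> i + length \<tau> \<le> length v \<and>
    order_isomorphic (take (length \<tau>) (drop i v)) \<tau>" for v :: "nat list" and i
  have occ: "occurrences \<tau> v = card {i. Q v i}" for v
    by (simp add: occurrences_def Q_def)
  have fin: "finite {i. Q w i}"
    by (rule finite_subset[of _ "{..length w}"]) (auto simp: Q_def)
  have Suc: "Q (x # w) (Suc i) \<longleftrightarrow> Q w i" for i by (simp add: Q_def)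
  have "{i. Q (x # w) i} = {i. i = 0 \<and> Q (x # w) 0} \<union> Suc ` {i. Q w i}"
  proof (intro equalityI subsetI)
    fix i assume "i \<in> {i. Q (x # w) i}"
    then show "i \<in> {i. i = 0 \<and> Q (x # w) 0} \<union> Suc ` {i. Q w i}"
      using Suc by (cases i) auto
  qed (use Suc in auto)
  moreover have "card {i::nat. i = 0 \<and> Q (x # w) 0} = of_bool (Q (x # w) 0)"
    by (cases "Q (x # w) 0") auto
  moreover have "card ({i::nat. i = 0 \<and> Q (x # w) 0} \<union> Suc ` {i. Q w i}) =
      card {i::nat. i = 0 \<and> Q (x # w) 0} + card (Suc ` {i. Q w i})"
    using fin by (subst card_Un_disjoint) auto
  ultimately have "card {i. Q (x # w) i} = of_bool (Q (x # w) 0) + card {i. Q w i}"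
    by (simp only: card_image[OF inj_on_subset[OF inj_Suc subset_UNIV]])
  then show ?thesis by (simp add: occ) (simp add: Q_def)
qed

text \<open>Order isomorphism compares all pairs of positions, but by transitivity the comparisons
  of neighbours determine the rest.\<close>

lemma order_isomorphic_pattern_iff_climbs:
  assumes \<tau>: "\<tau> = [1..<Suc u] @ replicate (Suc f) (Suc u)"
  shows "length \<tau> \<le> length (x # w) \<and> order_isomorphic (take (length \<tau>) (x # w)) \<tau> \<longleftrightarrow>
    climbs u f x w"
proof -
  have len: "length \<tau> = Suc (u + f)" by (simp add: \<tau>)
  \<comment> \<open>The pattern rises by one up to position \<open>u\<close> and is constant
    afterwards.\<close>
  have nth: "\<tau> ! i = Suc (min i u)" if "i \<le> u + f" for i
    using that by (auto simp: \<tau> nth_append simp del: upt_Suc replicate_Suc)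
  define v where "v = x # w"
  have iso: "order_isomorphic (take (length \<tau>) v) \<tau> \<longleftrightarrow>
      (\<forall>i\<le>u + f. \<forall>j\<le>u + f. (v ! i < v ! j \<longleftrightarrow> min i u < min j u) \<and>
        (v ! i = v ! j \<longleftrightarrow> min i u = min j u))" if "u + f \<le> length w"
  proof -
    have "length (take (length \<tau>) v) = Suc (u + f)" using that by (simp add: len v_def)
    moreover have "take (length \<tau>) v ! i = v ! i" if "i \<le> u + f" for i
      using that by (simp add: len)
    ultimately show ?thesis
      by (simp add: order_isomorphic_def len less_Suc_eq_le Suc_le_eq nth)
  qed
  show ?thesis
  proof (cases "u + f \<le> length w")
    case True
    have "order_isomorphic (take (length \<tau>) v) \<tau> \<longleftrightarrow>
        (\<forall>i<u. v ! i < v ! Suc i) \<and> (\<forall>i. u \<le> i \<and> i < u + f \<longrightarrow> v ! Suc i = v ! i)"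
      (is "?iso \<longleftrightarrow> ?steps")
    proof
      assume ?iso
      note * = this[unfolded iso[OF True], rule_format]
      show ?steps
      proof (intro conjI allI impI)
        fix i assume "i < u"
        then show "v ! i < v ! Suc i" using *[of i "Suc i"] by simp
      next
        fix i assume "u \<le> i \<and> i < u + f"
        then show "v ! Suc i = v ! i" using *[of "Suc i" i] by simp
      qed
    next
      assume steps: ?steps
      have up: "v ! i < v ! j" if "i < j" "j \<le> u" for i j
        using that
      proof (induction j)
        case (Suc j)
        then show ?case using steps by (cases "i = j") (auto intro: less_trans)
      qed simp
      have flat: "v ! i = v ! u" if "u \<le> i" "i \<le> u + f" for i
        using that by (induction i rule: dec_induct) (use steps in auto)
      \<comment> \<open>Positions on the plateau are replaced by \<open>u\<close>, so only
        comparisons within the strictly increasing part remain.\<close>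
      have vmin: "v ! i = v ! min i u" if "i \<le> u + f" for i
        using flat[of i] that by (cases "i \<le> u") (simp_all add: min_def)
      have "(v ! i < v ! j \<longleftrightarrow> i < j) \<and> (v ! i = v ! j \<longleftrightarrow> i = j)" if "i \<le> u" "j \<le> u" for i j
        using up[of i j] up[of j i] that by (cases i j rule: linorder_cases) auto
      from this[OF min.cobounded2 min.cobounded2] show ?iso
        unfolding iso[OF True] by (metis vmin)
    qed
    then show ?thesis unfolding climbs_iff_nth using True len by (simp add: v_def)
  qed (simp add: climbs_iff_nth len)
qed

lemma occurrences_pattern_Cons:
  assumes "\<tau> = [1..<Suc u] @ replicate (Suc f) (Suc u)"
  shows "occurrences \<tau> (x # w) = of_bool (climbs u f x w) + occurrences \<tau> w"
  unfolding occurrences_Cons order_isomorphic_pattern_iff_climbs[OF assms] ..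

lemma sum_avail_climbs_flat:
  assumes "nc_word p" "p \<noteq> []"
  shows "(\<Sum>c\<in>avail p. \<Sum>w\<in>extensions (p @ [c]) l. of_bool (climbs 0 (Suc f) (last p) (c # w))) =
    (\<Sum>w\<in>extensions (p @ [last p]) l. of_bool (climbs 0 f (last p) w) :: nat)"
proof -
  have "(\<Sum>c\<in>avail p. \<Sum>w\<in>extensions (p @ [c]) l. of_bool (climbs 0 (Suc f) (last p) (c # w))) =
      (\<Sum>c\<in>avail p. if c = last p
        then \<Sum>w\<in>extensions (p @ [c]) l. of_bool (climbs 0 f (last p) w) else (0::nat))"
    by (intro sum.cong refl) auto
  then show ?thesis using last_avail[OF assms] by simp
qed

text \<open>The first \<open>u\<close> letters are forced to be new, each adding one available
  letter. The next \<open>f\<close> repeat the last letter and change nothing. The remaining letters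
  are free, which gives a ballot number.\<close>

lemma sum_climbs_extensions:
  assumes "nc_word p" "p \<noteq> []"
  shows "(\<Sum>w\<in>extensions p l. of_bool (climbs u f (last p) w)) =
    (if u + f \<le> l then ballot (l - (u + f)) (card (avail p) + u) else 0)"
  using assms
proof (induction u arbitrary: l p)
  case (Suc u)
  note p = Suc.prems
  show ?case
  proof (cases l)
    case 0
    then show ?thesis using p by (simp add: extensions_0)
  next
    case l: (Suc k)
    let ?N = "new_letter p"
    \<comment> \<open>Available old letters are at most \<open>last p\<close>, so none of them can
      start with an ascent.\<close>
    have "(\<Sum>c\<in>avail p. \<Sum>w\<in>extensions (p @ [c]) k. of_bool (climbs (Suc u) f (last p) (c # w))) =
        (0 :: nat)"
      using last_avail(2)[OF p] by (intro sum.neutral ballI) (auto simp: not_less)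
    moreover have "last p < ?N" using last_avail(1)[OF p] less_new_letter p by blast
    ultimately have "(\<Sum>w\<in>extensions p l. of_bool (climbs (Suc u) f (last p) w)) =
        (\<Sum>w\<in>extensions (p @ [?N]) k. of_bool (climbs u f (last (p @ [?N])) w) :: nat)"
      using p by (simp add: l sum_extensions_Suc)
    also have "\<dots> = (if u + f \<le> k then ballot (k - (u + f)) (card (avail (p @ [?N])) + u) else 0)"
      using p nc_word_snoc[of p ?N] by (intro Suc.IH) auto
    finally show ?thesis using p by (simp add: l card_avail_snoc_new)
  qed
next
  case 0
  then show ?case
  proof (induction f arbitrary: l p)
    case 0
    then show ?case by (simp add: card_extensions)
  next
    case (Suc f)
    note p = Suc.prems
    show ?case
    proof (cases l)
      case 0
      then show ?thesis using p by (simp add: extensions_0)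
    next
      case l: (Suc k)
      let ?N = "new_letter p"
      have last: "last p \<in> avail p" "last p < ?N"
        using last_avail(1)[OF p] less_new_letter p by blast+
      then have "(\<Sum>w\<in>extensions p l. of_bool (climbs 0 (Suc f) (last p) w)) =
          (\<Sum>w\<in>extensions (p @ [last p]) k. of_bool (climbs 0 f (last (p @ [last p])) w) :: nat)"
        using p sum_avail_climbs_flat[OF p, of f k] by (simp add: l sum_extensions_Suc)
      also have "\<dots> = (if 0 + f \<le> k then ballot (k - (0 + f)) (card (avail (p @ [last p])) + 0) else 0)"
        using p nc_word_snoc[of p "last p"] last by (intro Suc.IH) auto
      \<comment> \<open>Repeating the largest available letter removes none.\<close>
      also have "avail (p @ [last p]) = avail p"
        using p last last_avail(2)[OF p] avail_snoc_old[of p "last p"] by auto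
      finally show ?thesis by (simp add: l)
    qed
  qed
qed

text \<open>The letter \<open>last p\<close> is kept in front of \<open>w\<close> because an
  occurrence may start there. Splitting off this possible occurrence yields the source term, and the
  first letter of \<open>w\<close> takes over the role of \<open>last p\<close>.\<close>

lemma sum_occurrences_extensions:
  assumes \<tau>: "\<tau> = [1..<Suc u] @ replicate (Suc f) (Suc u)" and "0 < u + f"
    and "nc_word p" "p \<noteq> []"
  shows "(\<Sum>w\<in>extensions p l. occurrences \<tau> (last p # w)) =
    (if u + f \<le> l then marked_ballot u (l - (u + f)) (card (avail p)) else 0)"
  using assms(3,4)
proof (induction l arbitrary: p)
  case 0
  have "\<tau> \<noteq> []" by (simp add: \<tau>)
  then show ?case using 0 assms(2)
    by (auto simp: extensions_0 occurrences_pattern_Cons[OF \<tau>] climbs_iff_nth occurrences_Nil)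
next
  case (Suc l)
  note p = Suc.prems
  let ?N = "new_letter p" and ?h = "card (avail p)"
  define T where "T h = (if u + f \<le> l then marked_ballot u (l - (u + f)) h else 0)" for h
  have IH: "(\<Sum>w\<in>extensions (p @ [c]) l. occurrences \<tau> (c # w)) = T (card (avail (p @ [c])))"
    if "c \<in> insert ?N (avail p)" for c
    using Suc.IH[of "p @ [c]"] nc_word_snoc[of p c] p that by (simp add: T_def)
  have "(\<Sum>w\<in>extensions p (Suc l). occurrences \<tau> (last p # w)) =
      (\<Sum>w\<in>extensions p (Suc l). of_bool (climbs u f (last p) w)) +
      (\<Sum>w\<in>extensions p (Suc l). occurrences \<tau> w)"
    by (simp only: occurrences_pattern_Cons[OF \<tau>] sum.distrib)
  also have "(\<Sum>w\<in>extensions p (Suc l). occurrences \<tau> w) =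
      T (Suc ?h) + (\<Sum>j=1..?h. T j)"
    using p IH sum_avail[of p T] by (simp add: sum_extensions_Suc card_avail_snoc_new)
  finally have *: "(\<Sum>w\<in>extensions p (Suc l). occurrences \<tau> (last p # w)) =
      (if u + f \<le> Suc l then ballot (Suc l - (u + f)) (?h + u) else 0) +
      (T (Suc ?h) + (\<Sum>j=1..?h. T j))"
    using sum_climbs_extensions[OF p] by simp
  show ?case
  proof (cases "u + f \<le> l")
    case True
    then have "Suc l - (u + f) = Suc (l - (u + f))" by simp
    then show ?thesis using True by (simp add: * T_def del: ballot.simps)
  next
    case False
    \<comment> \<open>At the boundary \<open>u + f = Suc l\<close> all values of \<open>T\<close>
      vanish and only \<open>ballot 0 (?h + u) = 1\<close> is left, the base value of
      \<open>marked_ballot\<close>.\<close>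
    then show ?thesis by (cases "u + f = Suc l") (auto simp: * T_def)
  qed
qed

text \<open>The first letter is always 1; it leaves one available letter and \<open>l\<close>
  letters to place.\<close>

lemma sum_occurrences_NC:
  assumes \<tau>: "\<tau> = [1..<Suc u] @ replicate (Suc f) (Suc u)" and "0 < u + f"
  shows "(\<Sum>P\<in>NC (Suc l). occurrences \<tau> (canonical_form (Suc l) P)) =
    (if u + f \<le> l then marked_ballot u (l - (u + f)) 1 else 0)"
proof -
  have empty: "nc_word []" "avail [] = {}" "new_letter [] = 1"
    by (auto simp: noncrossing_def avail_def new_letter_def)
  have one: "nc_word [1]" using nc_word_snoc[of "[]" 1] empty by simp
  have "card (avail [1]) = 1" using card_avail_snoc_new[of "[]"] empty by simp
  moreover have "(\<Sum>P\<in>NC (Suc l). occurrences \<tau> (canonical_form (Suc l) P)) =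
      (\<Sum>w\<in>extensions [] (Suc l). occurrences \<tau> w)"
    using sum.reindex_bij_betw[OF bij_betw_canonical_form_NC, of "occurrences \<tau>" "Suc l"]
    by (simp add: extensions_def)
  moreover have "\<dots> = (\<Sum>w\<in>extensions [1] l. occurrences \<tau> (1 # w))"
    using empty by (simp add: sum_extensions_Suc)
  ultimately show ?thesis using sum_occurrences_extensions[OF assms one, of l] by simp
qed

theorem corollary11:
  fixes a m n r :: nat and \<tau> :: "nat list"
  assumes "a \<ge> 2" and "m \<ge> 2"
    and "\<tau> = [1..<m] @ replicate a m"
    and "n \<ge> a + m - 1"
    and "r = n + 2 - (a + m)"
  shows "real (\<Sum>P\<in>NC n. occurrences \<tau> (canonical_form n P))
           = real r / real (2 * r + m) * real ((2 * r + m) choose r)"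
proof -
  \<comment> \<open>The pattern has \<open>u\<close> ascents and then \<open>f\<close> repetitions;
    \<open>q\<close> letters remain outside an occurrence. The bound on \<open>n\<close> ensures
    \<open>r = Suc q\<close>.\<close>
  define u f q where "u = m - 1" and "f = a - 1" and "q = r - 1"
  have eqs: "m = Suc u" "a = Suc f" "r = Suc q" and n: "n = Suc (q + u + f)" and "0 < u + f"
    using assms by (auto simp: u_def f_def q_def)
  have \<tau>: "\<tau> = [1..<Suc u] @ replicate (Suc f) (Suc u)" using assms(3) eqs by simp
  have "(\<Sum>P\<in>NC n. occurrences \<tau> (canonical_form n P)) = (2 * q + u + 2) choose q"
    using sum_occurrences_NC[OF \<tau> \<open>0 < u + f\<close>, of "q + u + f"] marked_ballot_one[of u q]
    by (simp add: n)
  \<comment> \<open>Absorption identity, since \<open>2 * r + m\<close> is the successor of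
    \<open>2 * q + u + 2\<close>.\<close>
  moreover have "r * ((2 * r + m) choose r) = (2 * r + m) * ((2 * q + u + 2) choose q)"
    using Suc_times_binomial[of q "2 * q + u + 2"] by (simp add: eqs)
  then have "real r * real ((2 * r + m) choose r) = real (2 * r + m) * real ((2 * q + u + 2) choose q)"
    by (metis of_nat_mult)
  moreover have "real (2 * r + m) \<noteq> 0" using eqs by simp
  ultimately show ?thesis by (simp only: divide_simps) (simp add: mult.commute)
qed

end
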